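(* Let $\mathcal C$ and $\mathcal D$ be categories with proper factorization systems $(\mathcal E_{\mathcal C},\mathcal M_{\mathcal C})$ and $(\mathcal E_{\mathcal D},\mathcal M_{\mathcal D})$, let $\mathsf F$ be a noetherian form on $\mathcal D$ inducing $(\mathcal E_{\mathcal D},\mathcal M_{\mathcal D})$, and let $T:\mathcal C\to\mathcal D$ be a functor. Let $T^*\mathsf F$ be the pullback form on $\mathcal C$: its fibre over $X$ is $\mathsf F(TX)$, and its transports along a morphism $f$ of $\mathcal C$ are the $\mathsf F$-transports $(Tf)_!\dashv (Tf)^*$ along $Tf$. The following are equivalent. (i) $T^*\mathsf F$ is a noetherian form whose induced factorization system is $(\mathcal E_{\mathcal C},\mathcal M_{\mathcal C})$. (ii) $T$ preserves the specified factorization systems, i.e. $T(\mathcal E_{\mathcal C})\subseteq\mathcal E_{\mathcal D}$ and $T(\mathcal M_{\mathcal C})\subseteq\mathcal M_{\mathcal D}$; $T$ is conservative (reflects isomorphisms); and pullbacks of two $\mathcal M_{\mathcal C}$-morphisms with common codomain and pushouts of two $\mathcal E_{\mathcal C}$-morphisms with common domain exist in $\mathcal C$ and are preserved by $T$.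
   Context: Conventions: categories are locally small; "set" is relative to a fixed universe. A proper factorization system $(\mathcal E,\mathcal M)$ is an orthogonal factorization system with every morphism in $\mathcal E$ an epimorphism and every morphism in $\mathcal M$ a monomorphism. Forms. An (orean) form $\mathsf F$ on a category $\mathcal C$ assigns to each object $X$ a set-sized bounded lattice $\mathsf F(X)$ (the fibre over $X$; its elements are called clusters) and to each morphism $f:X\to Y$ monotone maps $f_!:\mathsf F(X)\to\mathsf F(Y)$ and $f^*:\mathsf F(Y)\to\mathsf F(X)$ with $f_!S\le T\iff S\le f^*T$, such that $(gf)_!=g_!f_!$, $(gf)^*=f^*g^*$, and identities act as identities. Put $\operatorname{Im}f=f_!\top_X$ and $\operatorname{Ker}f=f^*\bot_Y$. A cluster in $\mathsf F(X)$ is conormal if it is the image of some morphism of $\mathcal C$ with codomain $X$, and normal if it is the kernel of some morphism of $\mathcal C$ with domain $X$. An embedding of a conormal $S\in\mathsf F(X)$ is a morphism $\iota$ into $X$ with $\operatorname{Im}\iota=S$ such that every morphism $f$ into $X$ with $\operatorname{Im}f\le S$ factors as $f=\iota h$ for a unique $h$. A quotient of a normal $K\in\mathsf F(X)$ is a morphism $\pi$ out of $X$ with $\operatorname{Ker}\pi=K$ such that every morphism $g$ out of $X$ with $K\le\operatorname{Ker}g$ factors as $g=h\pi$ for a unique $h$. The form is noetherian if: (N1) $f^*f_!S=S\vee\operatorname{Ker}f$ and $f_!f^*T=T\wedge\operatorname{Im}f$ for all $f,S,T$; (N2) every morphism $f$ factors as $f=me$ with $e$ a quotient of $\operatorname{Ker}f$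 and $m$ an embedding of $\operatorname{Im}f$; (N3) the join of two normal clusters (in the same fibre) is normal, and the meet of two conormal clusters is conormal. For a noetherian form, the class $\mathcal E$ of all quotients (of normal clusters) and the class $\mathcal M$ of all embeddings (of conormal clusters) form a proper factorization system, the one induced by the form. *)

theory Defs
  imports "HOL-Algebra.Lattice"
begin

section \<open>Categories and functors\<close>

text \<open>
  A category lives on a carrier set of objects and a carrier set of arrows. Composition is written
  in the applicative order: \<open>g \<cdot> f\<close> is first \<open>f\<close>, then \<open>g\<close>; its value is
  irrelevant when the arrows are not composable.
\<close>

record ('o, 'a) cat =
  Ob :: "'o set"
  Arr :: "'a set"
  Dom :: "'a \<Rightarrow> 'o"
  Cod :: "'a \<Rightarrow> 'o"
  Id :: "'o \<Rightarrow> 'a"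
  Comp :: "'a \<Rightarrow> 'a \<Rightarrow> 'a"  (infixl \<open>\<cdot>\<index>\<close> 70)

definition hom_set :: "('o, 'a) cat \<Rightarrow> 'o \<Rightarrow> 'o \<Rightarrow> 'a set" where
  "hom_set C X Y = {f \<in> Arr C. Dom C f = X \<and> Cod C f = Y}"

locale category =
  fixes C :: "('o, 'a) cat" (structure)
  assumes Dom_Ob: "f \<in> Arr C \<Longrightarrow> Dom C f \<in> Ob C"
    and Cod_Ob: "f \<in> Arr C \<Longrightarrow> Cod C f \<in> Ob C"
    and Id_hom: "X \<in> Ob C \<Longrightarrow> Id C X \<in> hom_set C X X"
    and Comp_hom: "f \<in> hom_set C X Y \<Longrightarrow> g \<in> hom_set C Y Z \<Longrightarrow> g \<cdot> f \<in> hom_set C X Z"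
    and Comp_assoc: "f \<in> hom_set C W X \<Longrightarrow> g \<in> hom_set C X Y \<Longrightarrow> h \<in> hom_set C Y Z \<Longrightarrow>
        (h \<cdot> g) \<cdot> f = h \<cdot> (g \<cdot> f)"
    and Comp_Id: "f \<in> hom_set C X Y \<Longrightarrow> f \<cdot> Id C X = f"
    and Id_Comp: "f \<in> hom_set C X Y \<Longrightarrow> Id C Y \<cdot> f = f"

definition is_mono :: "('o, 'a) cat \<Rightarrow> 'a \<Rightarrow> bool" where
  "is_mono C m \<longleftrightarrow> m \<in> Arr C \<and>
     (\<forall>f \<in> Arr C. \<forall>g \<in> Arr C. Dom C f = Dom C g \<and> Cod C f = Dom C m \<and> Cod C g = Dom C m \<and>
        m \<cdot>\<^bsub>C\<^esub> f = m \<cdot>\<^bsub>C\<^esub> g \<longrightarrow> f = g)"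

definition is_epi :: "('o, 'a) cat \<Rightarrow> 'a \<Rightarrow> bool" where
  "is_epi C e \<longleftrightarrow> e \<in> Arr C \<and>
     (\<forall>f \<in> Arr C. \<forall>g \<in> Arr C. Cod C f = Cod C g \<and> Dom C f = Cod C e \<and> Dom C g = Cod C e \<and>
        f \<cdot>\<^bsub>C\<^esub> e = g \<cdot>\<^bsub>C\<^esub> e \<longrightarrow> f = g)"

definition is_iso :: "('o, 'a) cat \<Rightarrow> 'a \<Rightarrow> bool" where
  "is_iso C f \<longleftrightarrow> f \<in> Arr C \<and>
     (\<exists>g \<in> hom_set C (Cod C f) (Dom C f).
        g \<cdot>\<^bsub>C\<^esub> f = Id C (Dom C f) \<and> f \<cdot>\<^bsub>C\<^esub> g = Id C (Cod C f))"

text \<open>\<open>is_pullback C m n p q\<close>: the span \<open>(p, q)\<close> is a pullback of the cospan \<open>(m, n)\<close>.\<close>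

definition is_pullback :: "('o, 'a) cat \<Rightarrow> 'a \<Rightarrow> 'a \<Rightarrow> 'a \<Rightarrow> 'a \<Rightarrow> bool" where
  "is_pullback C m n p q \<longleftrightarrow>
     m \<in> Arr C \<and> n \<in> Arr C \<and> p \<in> Arr C \<and> q \<in> Arr C \<and>
     Cod C m = Cod C n \<and> Dom C p = Dom C q \<and> Cod C p = Dom C m \<and> Cod C q = Dom C n \<and>
     m \<cdot>\<^bsub>C\<^esub> p = n \<cdot>\<^bsub>C\<^esub> q \<and>
     (\<forall>x \<in> Arr C. \<forall>y \<in> Arr C.
        Dom C x = Dom C y \<and> Cod C x = Dom C m \<and> Cod C y = Dom C n \<and> m \<cdot>\<^bsub>C\<^esub> x = n \<cdot>\<^bsub>C\<^esub> y \<longrightarrow>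
        (\<exists>!h. h \<in> hom_set C (Dom C x) (Dom C p) \<and> p \<cdot>\<^bsub>C\<^esub> h = x \<and> q \<cdot>\<^bsub>C\<^esub> h = y))"

text \<open>\<open>is_pushout C d e p q\<close>: the cospan \<open>(p, q)\<close> is a pushout of the span \<open>(d, e)\<close>.\<close>

definition is_pushout :: "('o, 'a) cat \<Rightarrow> 'a \<Rightarrow> 'a \<Rightarrow> 'a \<Rightarrow> 'a \<Rightarrow> bool" where
  "is_pushout C d e p q \<longleftrightarrow>
     d \<in> Arr C \<and> e \<in> Arr C \<and> p \<in> Arr C \<and> q \<in> Arr C \<and>
     Dom C d = Dom C e \<and> Cod C p = Cod C q \<and> Dom C p = Cod C d \<and> Dom C q = Cod C e \<and>
     p \<cdot>\<^bsub>C\<^esub> d = q \<cdot>\<^bsub>C\<^esub> e \<and>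
     (\<forall>x \<in> Arr C. \<forall>y \<in> Arr C.
        Cod C x = Cod C y \<and> Dom C x = Cod C d \<and> Dom C y = Cod C e \<and> x \<cdot>\<^bsub>C\<^esub> d = y \<cdot>\<^bsub>C\<^esub> e \<longrightarrow>
        (\<exists>!h. h \<in> hom_set C (Cod C p) (Cod C x) \<and> h \<cdot>\<^bsub>C\<^esub> p = x \<and> h \<cdot>\<^bsub>C\<^esub> q = y))"

record ('o1, 'a1, 'o2, 'a2) fctr =
  on_ob :: "'o1 \<Rightarrow> 'o2"
  on_arr :: "'a1 \<Rightarrow> 'a2"

locale cat_functor = dom: category C + cod: category D
  for C :: "('o1, 'a1) cat" and D :: "('o2, 'a2) cat" +
  fixes T :: "('o1, 'a1, 'o2, 'a2) fctr"
  assumes on_ob: "X \<in> Ob C \<Longrightarrow> on_ob T X \<in> Ob D"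
    and on_arr: "f \<in> hom_set C X Y \<Longrightarrow> on_arr T f \<in> hom_set D (on_ob T X) (on_ob T Y)"
    and on_Id: "X \<in> Ob C \<Longrightarrow> on_arr T (Id C X) = Id D (on_ob T X)"
    and on_Comp: "f \<in> hom_set C X Y \<Longrightarrow> g \<in> hom_set C Y Z \<Longrightarrow>
        on_arr T (g \<cdot>\<^bsub>C\<^esub> f) = on_arr T g \<cdot>\<^bsub>D\<^esub> on_arr T f"

definition conservative ::
  "('o1, 'a1) cat \<Rightarrow> ('o2, 'a2) cat \<Rightarrow> ('o1, 'a1, 'o2, 'a2) fctr \<Rightarrow> bool" where
  "conservative C D T \<longleftrightarrow> (\<forall>f \<in> Arr C. is_iso D (on_arr T f) \<longrightarrow> is_iso C f)"

section \<open>Proper factorization systems\<close>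

definition orthogonal :: "('o, 'a) cat \<Rightarrow> 'a \<Rightarrow> 'a \<Rightarrow> bool" where
  "orthogonal C e m \<longleftrightarrow>
     (\<forall>u \<in> hom_set C (Dom C e) (Dom C m). \<forall>v \<in> hom_set C (Cod C e) (Cod C m).
        m \<cdot>\<^bsub>C\<^esub> u = v \<cdot>\<^bsub>C\<^esub> e \<longrightarrow>
        (\<exists>!d. d \<in> hom_set C (Cod C e) (Dom C m) \<and> d \<cdot>\<^bsub>C\<^esub> e = u \<and> m \<cdot>\<^bsub>C\<^esub> d = v))"

locale orthogonal_factorization_system = category C
  for C :: "('o, 'a) cat" (structure) +
  fixes \<E> \<M> :: "'a set"
  assumes factorization:
      "f \<in> Arr C \<Longrightarrow> \<exists>e \<in> \<E>. \<exists>m \<in> \<M>. Cod C e = Dom C m \<and> f = m \<cdot> e"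
    and left_class: "\<E> = {e \<in> Arr C. \<forall>m \<in> \<M>. orthogonal C e m}"
    and right_class: "\<M> = {m \<in> Arr C. \<forall>e \<in> \<E>. orthogonal C e m}"

locale proper_factorization_system = orthogonal_factorization_system +
  assumes epi: "e \<in> \<E> \<Longrightarrow> is_epi C e"
    and mono: "m \<in> \<M> \<Longrightarrow> is_mono C m"

section \<open>Forms\<close>

text \<open>
  All fibres take their clusters from one type, but each has its own carrier and order.
  \<open>dir_tr F f\<close> is the direct transport $f_!$ and \<open>inv_tr F f\<close> the inverse transport $f^*$;
  as functions between fibres they only matter on the carriers.
\<close>

record ('o, 'a, 'c) form_data =
  fib :: "'o \<Rightarrow> 'c gorder"
  dir_tr :: "'a \<Rightarrow> 'c \<Rightarrow> 'c"
  inv_tr :: "'a \<Rightarrow> 'c \<Rightarrow> 'c"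

locale form = category C
  for C :: "('o, 'a) cat" (structure) +
  fixes F :: "('o, 'a, 'c) form_data"
  assumes fib_lattice: "X \<in> Ob C \<Longrightarrow> bounded_lattice (fib F X)"
    and dir_closed: "f \<in> hom_set C X Y \<Longrightarrow> dir_tr F f \<in> carrier (fib F X) \<rightarrow> carrier (fib F Y)"
    and dir_isotone: "f \<in> hom_set C X Y \<Longrightarrow> isotone (fib F X) (fib F Y) (dir_tr F f)"
    and inv_closed: "f \<in> hom_set C X Y \<Longrightarrow> inv_tr F f \<in> carrier (fib F Y) \<rightarrow> carrier (fib F X)"
    and inv_isotone: "f \<in> hom_set C X Y \<Longrightarrow> isotone (fib F Y) (fib F X) (inv_tr F f)"
    and adjoint: "f \<in> hom_set C X Y \<Longrightarrow> S \<in> carrier (fib F X) \<Longrightarrow> R \<in> carrier (fib F Y) \<Longrightarrow>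
        dir_tr F f S \<sqsubseteq>\<^bsub>fib F Y\<^esub> R \<longleftrightarrow> S \<sqsubseteq>\<^bsub>fib F X\<^esub> inv_tr F f R"
    and dir_Comp: "f \<in> hom_set C X Y \<Longrightarrow> g \<in> hom_set C Y Z \<Longrightarrow> S \<in> carrier (fib F X) \<Longrightarrow>
        dir_tr F (g \<cdot> f) S = dir_tr F g (dir_tr F f S)"
    and inv_Comp: "f \<in> hom_set C X Y \<Longrightarrow> g \<in> hom_set C Y Z \<Longrightarrow> R \<in> carrier (fib F Z) \<Longrightarrow>
        inv_tr F (g \<cdot> f) R = inv_tr F f (inv_tr F g R)"
    and dir_Id: "X \<in> Ob C \<Longrightarrow> S \<in> carrier (fib F X) \<Longrightarrow> dir_tr F (Id C X) S = S"
    and inv_Id: "X \<in> Ob C \<Longrightarrow> S \<in> carrier (fib F X) \<Longrightarrow> inv_tr F (Id C X) S = S"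

definition Im :: "('o, 'a) cat \<Rightarrow> ('o, 'a, 'c) form_data \<Rightarrow> 'a \<Rightarrow> 'c" where
  "Im C F f = dir_tr F f \<top>\<^bsub>fib F (Dom C f)\<^esub>"

definition Ker :: "('o, 'a) cat \<Rightarrow> ('o, 'a, 'c) form_data \<Rightarrow> 'a \<Rightarrow> 'c" where
  "Ker C F f = inv_tr F f \<bottom>\<^bsub>fib F (Cod C f)\<^esub>"

definition conormal :: "('o, 'a) cat \<Rightarrow> ('o, 'a, 'c) form_data \<Rightarrow> 'o \<Rightarrow> 'c \<Rightarrow> bool" where
  "conormal C F X S \<longleftrightarrow> (\<exists>f \<in> Arr C. Cod C f = X \<and> Im C F f = S)"

definition normal :: "('o, 'a) cat \<Rightarrow> ('o, 'a, 'c) form_data \<Rightarrow> 'o \<Rightarrow> 'c \<Rightarrow> bool" where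
  "normal C F X K \<longleftrightarrow> (\<exists>f \<in> Arr C. Dom C f = X \<and> Ker C F f = K)"

definition is_embedding ::
  "('o, 'a) cat \<Rightarrow> ('o, 'a, 'c) form_data \<Rightarrow> 'o \<Rightarrow> 'c \<Rightarrow> 'a \<Rightarrow> bool" where
  "is_embedding C F X S \<iota> \<longleftrightarrow>
     conormal C F X S \<and> \<iota> \<in> Arr C \<and> Cod C \<iota> = X \<and> Im C F \<iota> = S \<and>
     (\<forall>f \<in> Arr C. Cod C f = X \<and> Im C F f \<sqsubseteq>\<^bsub>fib F X\<^esub> S \<longrightarrow>
        (\<exists>!h. h \<in> hom_set C (Dom C f) (Dom C \<iota>) \<and> f = \<iota> \<cdot>\<^bsub>C\<^esub> h))"

definition is_quotient ::
  "('o, 'a) cat \<Rightarrow> ('o, 'a, 'c) form_data \<Rightarrow> 'o \<Rightarrow> 'c \<Rightarrow> 'a \<Rightarrow> bool" where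
  "is_quotient C F X K \<pi> \<longleftrightarrow>
     normal C F X K \<and> \<pi> \<in> Arr C \<and> Dom C \<pi> = X \<and> Ker C F \<pi> = K \<and>
     (\<forall>g \<in> Arr C. Dom C g = X \<and> K \<sqsubseteq>\<^bsub>fib F X\<^esub> Ker C F g \<longrightarrow>
        (\<exists>!h. h \<in> hom_set C (Cod C \<pi>) (Cod C g) \<and> g = h \<cdot>\<^bsub>C\<^esub> \<pi>))"

definition quotients :: "('o, 'a) cat \<Rightarrow> ('o, 'a, 'c) form_data \<Rightarrow> 'a set" where
  "quotients C F = {\<pi>. \<exists>X K. is_quotient C F X K \<pi>}"

definition embeddings :: "('o, 'a) cat \<Rightarrow> ('o, 'a, 'c) form_data \<Rightarrow> 'a set" where
  "embeddings C F = {\<iota>. \<exists>X S. is_embedding C F X S \<iota>}"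

locale noetherian_form = form +
  assumes inv_dir: "f \<in> hom_set C X Y \<Longrightarrow> S \<in> carrier (fib F X) \<Longrightarrow>
        inv_tr F f (dir_tr F f S) = S \<squnion>\<^bsub>fib F X\<^esub> Ker C F f"
    and dir_inv: "f \<in> hom_set C X Y \<Longrightarrow> R \<in> carrier (fib F Y) \<Longrightarrow>
        dir_tr F f (inv_tr F f R) = R \<sqinter>\<^bsub>fib F Y\<^esub> Im C F f"
    and quotient_embedding_factorization: "f \<in> hom_set C X Y \<Longrightarrow>
        \<exists>e m. is_quotient C F X (Ker C F f) e \<and> is_embedding C F Y (Im C F f) m \<and>
          Cod C e = Dom C m \<and> f = m \<cdot> e"
    and normal_join: "X \<in> Ob C \<Longrightarrow> normal C F X K \<Longrightarrow> normal C F X L \<Longrightarrow>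
        normal C F X (K \<squnion>\<^bsub>fib F X\<^esub> L)"
    and conormal_meet: "X \<in> Ob C \<Longrightarrow> conormal C F X S \<Longrightarrow> conormal C F X R \<Longrightarrow>
        conormal C F X (S \<sqinter>\<^bsub>fib F X\<^esub> R)"

definition induced_factorization_system ::
  "('o, 'a) cat \<Rightarrow> ('o, 'a, 'c) form_data \<Rightarrow> 'a set \<times> 'a set" where
  "induced_factorization_system C F = (quotients C F, embeddings C F)"

definition pullback_form ::
  "('o1, 'a1, 'o2, 'a2) fctr \<Rightarrow> ('o2, 'a2, 'c) form_data \<Rightarrow> ('o1, 'a1, 'c) form_data" where
  "pullback_form T F =
     \<lparr> fib = (\<lambda>X. fib F (on_ob T X)),
       dir_tr = (\<lambda>f. dir_tr F (on_arr T f)),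
       inv_tr = (\<lambda>f. inv_tr F (on_arr T f)) \<rparr>"

end

theory Submission
  imports Defs
begin

text \<open>
  In a noetherian form the embeddings are exactly the morphisms with kernel \<open>\<bottom>\<close>, and a commutative
  square \<open>m p = n q\<close> of embeddings \<open>m\<close>, \<open>n\<close> is a pullback iff \<open>m p\<close> is an embedding with image
  \<open>Im m \<sqinter> Im n\<close>. Both conditions are expressed by the form alone, so they can be read off from
  their images under \<open>T\<close>; this gives (i) \<open>\<Longrightarrow>\<close> (ii). Conversely, if \<open>Im (T f) \<le> Im (T m)\<close> with
  \<open>m \<in> \<M>\<^sub>C\<close>, factor \<open>f = n e\<close> and pull \<open>m\<close> back along \<open>n\<close>: the projection to the domain of \<open>n\<close>
  becomes invertible under \<open>T\<close>, hence is invertible, so \<open>f\<close> factors through \<open>m\<close>. Everything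
  about \<open>\<E>\<close> and pushouts follows by passing to opposite categories and reversing the fibres.
\<close>

section \<open>Duality\<close>

definition op_cat :: "('o, 'a) cat \<Rightarrow> ('o, 'a) cat" where
  "op_cat C = \<lparr>Ob = Ob C, Arr = Arr C, Dom = Cod C, Cod = Dom C, Id = Id C,
     Comp = (\<lambda>g f. f \<cdot>\<^bsub>C\<^esub> g)\<rparr>"

text \<open>Reversing every fibre turns the right adjoint into a left adjoint, so inverse transport
  along an arrow becomes direct transport along its opposite. Images and kernels trade places, and
  with them embeddings and quotients.\<close>

definition op_form :: "('o, 'a, 'c) form_data \<Rightarrow> ('o, 'a, 'c) form_data" where
  "op_form F = \<lparr>fib = (\<lambda>X. inv_gorder (fib F X)), dir_tr = inv_tr F, inv_tr = dir_tr F\<rparr>"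

lemma op_cat_simps [simp]:
  "Ob (op_cat C) = Ob C" "Arr (op_cat C) = Arr C" "Dom (op_cat C) = Cod C"
  "Cod (op_cat C) = Dom C" "Id (op_cat C) = Id C" "g \<cdot>\<^bsub>op_cat C\<^esub> f = f \<cdot>\<^bsub>C\<^esub> g"
  by (simp_all add: op_cat_def)

lemma op_form_simps [simp]:
  "fib (op_form F) X = inv_gorder (fib F X)" "dir_tr (op_form F) = inv_tr F"
  "inv_tr (op_form F) = dir_tr F"
  by (simp_all add: op_form_def)

lemma hom_set_op [simp]: "hom_set (op_cat C) X Y = hom_set C Y X"
  by (auto simp: hom_set_def)

lemma category_op: "category C \<Longrightarrow> category (op_cat C)"
  unfolding category_def by (auto simp: hom_set_def)

lemma is_mono_op: "is_mono (op_cat C) = is_epi C"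
  by (rule ext) (auto simp: is_mono_def is_epi_def)

lemma is_epi_op: "is_epi (op_cat C) = is_mono C"
  by (rule ext) (auto simp: is_mono_def is_epi_def)

lemma is_iso_op: "is_iso (op_cat C) = is_iso C"
  by (rule ext) (auto simp: is_iso_def)

lemma is_pullback_op: "is_pullback (op_cat C) = is_pushout C"
  by (intro ext) (simp add: is_pullback_def is_pushout_def)

lemma orthogonal_op: "orthogonal (op_cat C) e m = orthogonal C m e"
proof -
  \<comment> \<open>The opposite lifting problem has its two triangles in the other order and its
    square equation reversed; \<open>swap\<close> and \<open>eq\<close> undo both.\<close>
  have swap: "(\<exists>!d. P d \<and> Q d \<and> R d) \<longleftrightarrow> (\<exists>!d. P d \<and> R d \<and> Q d)" for P Q R :: "'b \<Rightarrow> bool"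
    by metis
  have eq: "u \<cdot>\<^bsub>C\<^esub> m = e \<cdot>\<^bsub>C\<^esub> v \<longleftrightarrow> e \<cdot>\<^bsub>C\<^esub> v = u \<cdot>\<^bsub>C\<^esub> m" for u v
    by (rule eq_commute)
  show ?thesis
    unfolding orthogonal_def op_cat_simps hom_set_op eq by (subst swap) blast
qed

lemma proper_factorization_system_op:
  assumes "proper_factorization_system C \<E> \<M>"
  shows "proper_factorization_system (op_cat C) \<M> \<E>"
proof -
  interpret proper_factorization_system C \<E> \<M> by fact
  interpret op: category "op_cat C" using category_axioms by (rule category_op)
  show ?thesis
  proof unfold_locales
    show "\<exists>e\<in>\<M>. \<exists>m\<in>\<E>. Cod (op_cat C) e = Dom (op_cat C) m \<and> f = m \<cdot>\<^bsub>op_cat C\<^esub> e"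
      if "f \<in> Arr (op_cat C)" for f
      using factorization[of f] that unfolding op_cat_simps by metis
    show "\<M> = {e \<in> Arr (op_cat C). \<forall>m\<in>\<E>. orthogonal (op_cat C) e m}"
      unfolding orthogonal_op op_cat_simps by (rule right_class)
    show "\<E> = {m \<in> Arr (op_cat C). \<forall>e\<in>\<M>. orthogonal (op_cat C) e m}"
      unfolding orthogonal_op op_cat_simps by (rule left_class)
  qed (simp_all add: is_mono_op is_epi_op mono epi)
qed

lemma cat_functor_op:
  assumes "cat_functor C D T"
  shows "cat_functor (op_cat C) (op_cat D) T"
proof -
  interpret cat_functor C D T by fact
  interpret op_dom: category "op_cat C" using dom.category_axioms by (rule category_op)
  interpret op_cod: category "op_cat D" using cod.category_axioms by (rule category_op)
  show ?thesis
    by unfold_locales (auto simp: on_ob on_Id on_arr on_Comp)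
qed

lemma conservative_op: "conservative (op_cat C) (op_cat D) T = conservative C D T"
  by (simp add: conservative_def is_iso_op)

lemma Im_op: "Im (op_cat C) (op_form F) = Ker C F"
  by (rule ext) (simp add: Im_def Ker_def)

lemma Ker_op: "Ker (op_cat C) (op_form F) = Im C F"
  by (rule ext) (simp add: Im_def Ker_def)

lemma conormal_op: "conormal (op_cat C) (op_form F) = normal C F"
  by (intro ext) (simp add: conormal_def normal_def Im_op)

lemma normal_op: "normal (op_cat C) (op_form F) = conormal C F"
  by (intro ext) (simp add: conormal_def normal_def Ker_op)

lemma is_embedding_op: "is_embedding (op_cat C) (op_form F) = is_quotient C F"
  by (intro ext) (simp add: is_embedding_def is_quotient_def conormal_op Im_op)

lemma is_quotient_op: "is_quotient (op_cat C) (op_form F) = is_embedding C F"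
  by (intro ext) (simp add: is_embedding_def is_quotient_def normal_op Ker_op)

lemma embeddings_op: "embeddings (op_cat C) (op_form F) = quotients C F"
  by (simp add: embeddings_def quotients_def is_embedding_op)

lemma quotients_op: "quotients (op_cat C) (op_form F) = embeddings C F"
  by (simp add: embeddings_def quotients_def is_quotient_op)

lemma pullback_form_op: "pullback_form T (op_form F) = op_form (pullback_form T F)"
  by (simp add: pullback_form_def op_form_def)

lemma pullback_form_simps [simp]:
  "fib (pullback_form T F) X = fib F (on_ob T X)"
  "dir_tr (pullback_form T F) f = dir_tr F (on_arr T f)"
  "inv_tr (pullback_form T F) f = inv_tr F (on_arr T f)"
  by (simp_all add: pullback_form_def)

lemma dual_bounded_lattice:
  assumes "bounded_lattice L"
  shows "bounded_lattice (inv_gorder L)"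
proof -
  interpret bounded_lattice L by fact
  interpret op: lattice "inv_gorder L" by (rule dual_lattice)
  show ?thesis
    by unfold_locales (use bottom_exists top_exists in auto)
qed

lemma isotone_dual:
  assumes "isotone A B f"
  shows "isotone (inv_gorder A) (inv_gorder B) f"
proof -
  interpret weak_partial_order A using assms by (simp add: isotone_def)
  show ?thesis using assms by simp
qed

lemma form_op:
  assumes "form C F"
  shows "form (op_cat C) (op_form F)"
proof -
  interpret form C F by fact
  interpret op: category "op_cat C" using category_axioms by (rule category_op)
  show ?thesis
    by (intro form.intro form_axioms.intro op.category_axioms)
      (simp_all add: dual_bounded_lattice fib_lattice isotone_dual dir_isotone inv_isotone
        dir_closed inv_closed adjoint dir_Comp inv_Comp dir_Id inv_Id)
qed

lemma noetherian_form_op: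
  assumes "noetherian_form C F"
  shows "noetherian_form (op_cat C) (op_form F)"
proof -
  interpret noetherian_form C F by fact
  interpret op: form "op_cat C" "op_form F" using form_axioms by (rule form_op)
  show ?thesis
  proof unfold_locales
    fix f X Y assume "f \<in> hom_set (op_cat C) X Y"
    then show "\<exists>e m. is_quotient (op_cat C) (op_form F) X (Ker (op_cat C) (op_form F) f) e \<and>
        is_embedding (op_cat C) (op_form F) Y (Im (op_cat C) (op_form F) f) m \<and>
        Cod (op_cat C) e = Dom (op_cat C) m \<and> f = m \<cdot>\<^bsub>op_cat C\<^esub> e"
      using quotient_embedding_factorization[of f Y X]
      unfolding is_quotient_op is_embedding_op Ker_op Im_op op_cat_simps hom_set_op by metis
  qed (simp_all add: inv_dir dir_inv Ker_op Im_op normal_op conormal_op normal_join conormal_meet)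
qed

section \<open>Noetherian forms\<close>

context category
begin

lemma hom_setD: "f \<in> hom_set C X Y \<Longrightarrow>
   f \<in> Arr C \<and> Dom C f = X \<and> Cod C f = Y \<and> X \<in> Ob C \<and> Y \<in> Ob C"
  using Dom_Ob Cod_Ob by (auto simp: hom_set_def)

text \<open>Trades the domain and codomain equations in \<open>is_pullback\<close> for typed
  hom-sets, so that cones can be handled with a named vertex.\<close>

lemma is_pullback_iff:
  assumes m: "m \<in> hom_set C A X" and n: "n \<in> hom_set C B X"
    and p: "p \<in> hom_set C P A" and q: "q \<in> hom_set C P B"
  shows "is_pullback C m n p q \<longleftrightarrow> m \<cdot> p = n \<cdot> q \<and>
    (\<forall>Z. \<forall>x \<in> hom_set C Z A. \<forall>y \<in> hom_set C Z B. m \<cdot> x = n \<cdot> y \<longrightarrow>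
      (\<exists>!h. h \<in> hom_set C Z P \<and> p \<cdot> h = x \<and> q \<cdot> h = y))"
proof -
  have hom_iff: "(\<forall>Z. \<forall>x \<in> hom_set C Z A. \<forall>y \<in> hom_set C Z B. R x y \<longrightarrow> Q Z x y) \<longleftrightarrow>
      (\<forall>x \<in> Arr C. \<forall>y \<in> Arr C.
        Dom C x = Dom C y \<and> Cod C x = A \<and> Cod C y = B \<and> R x y \<longrightarrow> Q (Dom C x) x y)" for R Q
    unfolding hom_set_def by (smt (verit) mem_Collect_eq)
  show ?thesis
    unfolding is_pullback_def hom_iff
    using hom_setD[OF m] hom_setD[OF n] hom_setD[OF p] hom_setD[OF q] by simp
qed

end

section \<open>Calculus of images\<close>

context form
begin

lemma Im_closed: "f \<in> hom_set C X Y \<Longrightarrow> Im C F f \<in> carrier (fib F Y)"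
  using dir_closed[of f X Y] hom_setD[of f X Y] bounded_lattice.axioms(3)[OF fib_lattice[of X]]
  by (auto simp: Im_def weak_partial_order_top.top_closed)

lemma Im_Comp: "f \<in> hom_set C X Y \<Longrightarrow> g \<in> hom_set C Y Z \<Longrightarrow> Im C F (g \<cdot> f) = dir_tr F g (Im C F f)"
  using hom_setD[of f X Y] hom_setD[of "g \<cdot> f" X Z] Comp_hom[of f X Y g Z]
    bounded_lattice.axioms(3)[OF fib_lattice[of X]]
  by (simp add: Im_def dir_Comp weak_partial_order_top.top_closed)

text \<open>Direct transport along \<open>g\<close> is monotone and sends the image of
  \<open>f\<close>, which lies below top, to the image of the composite.\<close>

lemma Im_Comp_le:
  assumes f: "f \<in> hom_set C X Y" and g: "g \<in> hom_set C Y Z"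
  shows "Im C F (g \<cdot> f) \<sqsubseteq>\<^bsub>fib F Z\<^esub> Im C F g"
proof -
  interpret Y: bounded_lattice "fib F Y" using hom_setD[OF f] fib_lattice by simp
  show ?thesis
    using use_iso2[OF dir_isotone[OF g] Im_closed[OF f] Y.top_closed Y.top_higher[OF Im_closed[OF f]]]
      hom_setD[OF g] Im_Comp[OF f g] by (simp add: Im_def)
qed

lemma Im_Comp_eq:
  "f \<in> hom_set C X Y \<Longrightarrow> g \<in> hom_set C Y Z \<Longrightarrow> Im C F f = \<top>\<^bsub>fib F Y\<^esub> \<Longrightarrow>
   Im C F (g \<cdot> f) = Im C F g"
  using Im_Comp[of f X Y g Z] hom_setD[of g Y Z] by (simp add: Im_def)

lemma Im_Id: "X \<in> Ob C \<Longrightarrow> Im C F (Id C X) = \<top>\<^bsub>fib F X\<^esub>"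
  using hom_setD[OF Id_hom[of X]] bounded_lattice.axioms(3)[OF fib_lattice[of X]]
  by (simp add: Im_def dir_Id weak_partial_order_top.top_closed)

text \<open>The identity has full image and factors through \<open>f\<close>, so its image lies
  below that of \<open>f\<close>.\<close>

lemma Im_split_epi:
  assumes f: "f \<in> hom_set C X Y" and g: "g \<in> hom_set C Y X" and fg: "f \<cdot> g = Id C Y"
  shows "Im C F f = \<top>\<^bsub>fib F Y\<^esub>"
proof -
  have Y: "Y \<in> Ob C" using hom_setD[OF f] by simp
  interpret Y: bounded_lattice "fib F Y" using Y by (rule fib_lattice)
  show ?thesis
    using Im_Comp_le[OF g f] Im_closed[OF f] unfolding fg Im_Id[OF Y] by auto
qed

section \<open>Kernels, obtained as images in the opposite category\<close>

interpretation op: form "op_cat C" "op_form F" by (rule form_op) (rule form_axioms)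

lemma Ker_closed: "f \<in> hom_set C X Y \<Longrightarrow> Ker C F f \<in> carrier (fib F X)"
  using op.Im_closed by (simp add: Im_op)

lemma Ker_Comp_eq:
  "f \<in> hom_set C X Y \<Longrightarrow> g \<in> hom_set C Y Z \<Longrightarrow> Ker C F g = \<bottom>\<^bsub>fib F Y\<^esub> \<Longrightarrow>
   Ker C F (g \<cdot> f) = Ker C F f"
  using op.Im_Comp_eq[of g Z Y f X] by (simp add: Im_op)

lemma Ker_split_mono:
  "f \<in> hom_set C X Y \<Longrightarrow> g \<in> hom_set C Y X \<Longrightarrow> g \<cdot> f = Id C X \<Longrightarrow> Ker C F f = \<bottom>\<^bsub>fib F X\<^esub>"
  using op.Im_split_epi[of f Y X g] by (simp add: Im_op)

lemma iso_Im_Ker: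
  assumes "is_iso C f" and "f \<in> hom_set C X Y"
  shows "Im C F f = \<top>\<^bsub>fib F Y\<^esub>" and "Ker C F f = \<bottom>\<^bsub>fib F X\<^esub>"
  using assms Im_split_epi[of f X Y] Ker_split_mono[of f X Y] by (auto simp: is_iso_def hom_set_def)

section \<open>Embeddings and their universal property\<close>

lemma embeddingD:
  assumes "is_embedding C F X S m"
  shows "m \<in> hom_set C (Dom C m) X" and "Im C F m = S" and "conormal C F X S"
  using assms by (auto simp: is_embedding_def hom_set_def)

lemma embeddings_arr: "f \<in> embeddings C F \<Longrightarrow> f \<in> hom_set C (Dom C f) (Cod C f)"
  by (auto simp: embeddings_def is_embedding_def hom_set_def)

lemma embedding_factor:
  "is_embedding C F X S m \<Longrightarrow> f \<in> hom_set C Z X \<Longrightarrow> Im C F f \<sqsubseteq>\<^bsub>fib F X\<^esub> S \<Longrightarrow>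
   \<exists>h \<in> hom_set C Z (Dom C m). f = m \<cdot> h"
  unfolding is_embedding_def hom_set_def by fast

text \<open>The two composites are one morphism, whose image lies below \<open>S\<close>; uniqueness
  of its factorization through \<open>m\<close> forces \<open>u = v\<close>.\<close>

lemma embedding_cancel:
  assumes m: "is_embedding C F X S m" and u: "u \<in> hom_set C Z (Dom C m)"
    and v: "v \<in> hom_set C Z (Dom C m)" and eq: "m \<cdot> u = m \<cdot> v"
  shows "u = v"
proof -
  have mu: "m \<cdot> u \<in> hom_set C Z X" using u embeddingD(1)[OF m] by (rule Comp_hom)
  have "Im C F (m \<cdot> u) \<sqsubseteq>\<^bsub>fib F X\<^esub> S"
    using Im_Comp_le[OF u embeddingD(1)[OF m]] embeddingD(2)[OF m] by simp
  then have "\<exists>!h. h \<in> hom_set C Z (Dom C m) \<and> m \<cdot> u = m \<cdot> h"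
    using m hom_setD[OF mu] unfolding is_embedding_def by metis
  then show ?thesis using u v eq by metis
qed

text \<open>Splits unique factorization into existence and cancellability. Conormality of the image
  is automatic, with \<open>m\<close> itself as witness.\<close>

lemma embeddingI:
  assumes m: "m \<in> hom_set C A X"
    and factor: "\<And>f Z. f \<in> hom_set C Z X \<Longrightarrow> Im C F f \<sqsubseteq>\<^bsub>fib F X\<^esub> Im C F m \<Longrightarrow>
      \<exists>h \<in> hom_set C Z A. f = m \<cdot> h"
    and cancel: "\<And>u v Z. u \<in> hom_set C Z A \<Longrightarrow> v \<in> hom_set C Z A \<Longrightarrow> m \<cdot> u = m \<cdot> v \<Longrightarrow> u = v"
  shows "is_embedding C F X (Im C F m) m"
proof -
  have m': "m \<in> Arr C" "Dom C m = A" "Cod C m = X" using hom_setD[OF m] by auto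
  have "\<exists>!h. h \<in> hom_set C (Dom C f) A \<and> f = m \<cdot> h"
    if "f \<in> Arr C" "Cod C f = X" "Im C F f \<sqsubseteq>\<^bsub>fib F X\<^esub> Im C F m" for f
    using factor[of f "Dom C f"] cancel that by (auto simp: hom_set_def)
  then show ?thesis
    using m' unfolding is_embedding_def conormal_def by auto
qed

end

section \<open>Embeddings as morphisms with trivial kernel\<close>

context noetherian_form
begin

text \<open>In the factorization \<open>m = m' \<cdot> e'\<close> the embedding \<open>m'\<close>
  has the image of \<open>m\<close>, hence factors as \<open>m \<cdot> h\<close>. Cancelling
  \<open>m\<close> shows that \<open>h\<close> is a left inverse of \<open>e'\<close>, so
  \<open>e'\<close> has trivial kernel, and its kernel is that of \<open>m\<close>.\<close>

lemma Ker_embedding: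
  assumes m: "is_embedding C F X S m"
  shows "Ker C F m = \<bottom>\<^bsub>fib F (Dom C m)\<^esub>"
proof -
  note mh = embeddingD(1)[OF m]
  obtain e' m' where e': "is_quotient C F (Dom C m) (Ker C F m) e'"
    and m': "is_embedding C F X (Im C F m) m'" and c: "Cod C e' = Dom C m'" and f: "m = m' \<cdot> e'"
    using quotient_embedding_factorization[OF mh] by blast
  have e'h: "e' \<in> hom_set C (Dom C m) (Dom C m')"
    using e' c by (simp add: is_quotient_def hom_set_def)
  note m'h = embeddingD(1)[OF m']
  interpret X: bounded_lattice "fib F X" using hom_setD[OF mh] fib_lattice by simp
  have "Im C F m' \<sqsubseteq>\<^bsub>fib F X\<^esub> S"
    using embeddingD(2)[OF m] embeddingD(2)[OF m'] Im_closed[OF mh] by simp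
  then obtain h where h: "h \<in> hom_set C (Dom C m') (Dom C m)" "m' = m \<cdot> h"
    using embedding_factor[OF m m'h] by blast
  have "m \<cdot> (h \<cdot> e') = m \<cdot> Id C (Dom C m)"
    using Comp_assoc[OF e'h h(1) mh] h(2)[symmetric] f[symmetric] Comp_Id[OF mh] by simp
  then have "h \<cdot> e' = Id C (Dom C m)"
    using embedding_cancel[OF m Comp_hom[OF e'h h(1)] Id_hom] hom_setD[OF mh] by simp
  then show ?thesis
    using Ker_split_mono[OF e'h h(1)] e' by (simp add: is_quotient_def)
qed

text \<open>Write \<open>f = m \<cdot> e\<close>. The quotient \<open>e\<close> has kernel bottom,
  so every arrow out of \<open>X\<close> factors through it, in particular the identity. Thus
  \<open>e\<close> is invertible and \<open>f\<close> inherits the universal property of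
  \<open>m\<close>.\<close>

lemma embedding_if_Ker:
  assumes f: "f \<in> hom_set C X Y" and K: "Ker C F f = \<bottom>\<^bsub>fib F X\<^esub>"
  shows "is_embedding C F Y (Im C F f) f"
proof -
  obtain e m where e: "is_quotient C F X (Ker C F f) e" and m: "is_embedding C F Y (Im C F f) m"
    and c: "Cod C e = Dom C m" and fme: "f = m \<cdot> e"
    using quotient_embedding_factorization[OF f] by blast
  have eh: "e \<in> hom_set C X (Dom C m)" using e c by (simp add: is_quotient_def hom_set_def)
  note mh = embeddingD(1)[OF m]
  have X: "X \<in> Ob C" and Z: "Dom C m \<in> Ob C" using hom_setD[OF eh] by auto
  interpret X: bounded_lattice "fib F X" using X by (rule fib_lattice)
  have fact: "\<exists>!h. h \<in> hom_set C (Dom C m) (Cod C g) \<and> g = h \<cdot> e"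
    if "g \<in> Arr C" "Dom C g = X" "\<bottom>\<^bsub>fib F X\<^esub> \<sqsubseteq>\<^bsub>fib F X\<^esub> Ker C F g" for g
    using e that c K unfolding is_quotient_def by metis
  obtain h where h: "h \<in> hom_set C (Dom C m) X" "Id C X = h \<cdot> e"
    using fact[of "Id C X"] hom_setD[OF Id_hom[OF X]] X.bottom_lower[OF Ker_closed[OF Id_hom[OF X]]]
    by auto
  \<comment> \<open>Both \<open>e \<cdot> h\<close> and the identity factor \<open>e\<close> through
    itself, so uniqueness makes the left inverse \<open>h\<close> two-sided.\<close>
  have "(e \<cdot> h) \<cdot> e = e" using Comp_assoc[OF eh h(1) eh] h(2) Comp_Id[OF eh] by simp
  moreover have "Id C (Dom C m) \<cdot> e = e" by (rule Id_Comp[OF eh])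
  ultimately have eh_id: "e \<cdot> h = Id C (Dom C m)"
    using fact[of e] hom_setD[OF eh] X.bottom_lower[OF Ker_closed[OF eh]]
      Comp_hom[OF h(1) eh] Id_hom[OF Z] by metis
  show ?thesis
  proof (rule embeddingI[OF f])
    fix g Z assume g: "g \<in> hom_set C Z Y" "Im C F g \<sqsubseteq>\<^bsub>fib F Y\<^esub> Im C F f"
    obtain k where k: "k \<in> hom_set C Z (Dom C m)" "g = m \<cdot> k" using embedding_factor[OF m g] by blast
    have "f \<cdot> (h \<cdot> k) = m \<cdot> (e \<cdot> (h \<cdot> k))"
      using Comp_assoc[OF Comp_hom[OF k(1) h(1)] eh mh] fme by simp
    also have "\<dots> = g" using Comp_assoc[OF k(1) h(1) eh] eh_id Id_Comp[OF k(1)] k(2) by simp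
    finally show "\<exists>h\<in>hom_set C Z X. g = f \<cdot> h" using Comp_hom[OF k(1) h(1)] by metis
  next
    fix u v Z assume u: "u \<in> hom_set C Z X" and v: "v \<in> hom_set C Z X" and eq: "f \<cdot> u = f \<cdot> v"
    have "m \<cdot> (e \<cdot> u) = m \<cdot> (e \<cdot> v)"
      using eq Comp_assoc[OF u eh mh] Comp_assoc[OF v eh mh] fme by simp
    then have "e \<cdot> u = e \<cdot> v"
      by (rule embedding_cancel[OF m Comp_hom[OF u eh] Comp_hom[OF v eh]])
    then show "u = v"
      using Comp_assoc[OF u eh h(1)] Comp_assoc[OF v eh h(1)] h(2) Id_Comp[OF u] Id_Comp[OF v] by simp
  qed
qed

text \<open>Reduces membership to an equation in one fibre, which a functor can transfer without
  transporting any universal property.\<close>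

lemma embeddings_iff: "f \<in> hom_set C X Y \<Longrightarrow> f \<in> embeddings C F \<longleftrightarrow> Ker C F f = \<bottom>\<^bsub>fib F X\<^esub>"
  using embedding_if_Ker[of f X Y] Ker_embedding[of _ _ f] hom_setD[of f X Y]
  by (auto simp: embeddings_def)

lemma embedding_of_Im: "f \<in> embeddings C F \<Longrightarrow> is_embedding C F (Cod C f) (Im C F f) f"
  by (auto simp: embeddings_def is_embedding_def)

text \<open>A trivial kernel makes \<open>f\<close> an embedding. Its image is top, so the identity
  of \<open>Y\<close> factors through it, which gives a right inverse; cancelling \<open>f\<close>
  makes it a left inverse too.\<close>

lemma iso_if_Im_Ker:
  assumes f: "f \<in> hom_set C X Y" and K: "Ker C F f = \<bottom>\<^bsub>fib F X\<^esub>" and I: "Im C F f = \<top>\<^bsub>fib F Y\<^esub>"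
  shows "is_iso C f"
proof -
  note f' = hom_setD[OF f]
  note emb = embedding_if_Ker[OF f K]
  have X: "X \<in> Ob C" and Y: "Y \<in> Ob C" using f' by auto
  interpret Y: bounded_lattice "fib F Y" using Y by (rule fib_lattice)
  obtain h where h: "h \<in> hom_set C Y X" "Id C Y = f \<cdot> h"
    using embedding_factor[OF emb Id_hom[OF Y]] I Im_Id[OF Y] f' by auto
  have "f \<cdot> (h \<cdot> f) = f \<cdot> Id C X"
    using Comp_assoc[OF f h(1) f] h(2) Id_Comp[OF f] Comp_Id[OF f] by simp
  then have "h \<cdot> f = Id C X"
    using embedding_cancel[OF emb] Comp_hom[OF f h(1)] Id_hom[OF X] f' by simp
  then show ?thesis using h f' unfolding is_iso_def by auto
qed

section \<open>Meets of images and pullbacks of embeddings\<close>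

lemma conormal_embedding:
  assumes "conormal C F X S"
  obtains k where "is_embedding C F X S k"
proof -
  obtain f where f: "f \<in> hom_set C (Dom C f) X" "Im C F f = S"
    using assms by (auto simp: conormal_def hom_set_def)
  show thesis using quotient_embedding_factorization[OF f(1)] f(2) that by blast
qed

lemma conormal_Im: "f \<in> hom_set C X Y \<Longrightarrow> conormal C F Y (Im C F f)"
  by (auto simp: conormal_def hom_set_def)

text \<open>The common composite of a cone has image below both images, hence below their meet, so
  it factors through the embedding \<open>m \<cdot> p\<close>. Cancelling \<open>m\<close> and
  \<open>n\<close> recovers the two legs.\<close>

lemma pullback_of_embeddings:
  assumes m: "m \<in> embeddings C F" "m \<in> hom_set C A X" and n: "n \<in> embeddings C F" "n \<in> hom_set C B X"
    and p: "p \<in> hom_set C P A" and q: "q \<in> hom_set C P B" and eq: "m \<cdot> p = n \<cdot> q"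
    and mono: "Ker C F (m \<cdot> p) = \<bottom>\<^bsub>fib F P\<^esub>"
    and meet: "Im C F (m \<cdot> p) = Im C F m \<sqinter>\<^bsub>fib F X\<^esub> Im C F n"
  shows "is_pullback C m n p q"
proof -
  note Cm = hom_setD[OF m(2)] and Cn = hom_setD[OF n(2)]
  interpret X: bounded_lattice "fib F X" using Cm fib_lattice by simp
  have em: "is_embedding C F X (Im C F m) m" and en: "is_embedding C F X (Im C F n) n"
    using embedding_of_Im[OF m(1)] embedding_of_Im[OF n(1)] Cm Cn by simp_all
  have ek: "is_embedding C F X (Im C F (m \<cdot> p)) (m \<cdot> p)"
    using Comp_hom[OF p m(2)] mono by (rule embedding_if_Ker)
  have Ck: "Dom C (m \<cdot> p) = P" using hom_setD[OF Comp_hom[OF p m(2)]] by simp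
  have "\<exists>!h. h \<in> hom_set C Z P \<and> p \<cdot> h = x \<and> q \<cdot> h = y"
    if x: "x \<in> hom_set C Z A" and y: "y \<in> hom_set C Z B" and xy: "m \<cdot> x = n \<cdot> y" for x y Z
  proof -
    have mx: "m \<cdot> x \<in> hom_set C Z X" using x m(2) by (rule Comp_hom)
    have "Im C F (m \<cdot> x) \<sqsubseteq>\<^bsub>fib F X\<^esub> Im C F (m \<cdot> p)"
      unfolding meet
    proof (rule X.meet_le)
      show "Im C F (m \<cdot> x) \<sqsubseteq>\<^bsub>fib F X\<^esub> Im C F m" using x m(2) by (rule Im_Comp_le)
      show "Im C F (m \<cdot> x) \<sqsubseteq>\<^bsub>fib F X\<^esub> Im C F n" unfolding xy using y n(2) by (rule Im_Comp_le)
    qed (use Im_closed m(2) n(2) mx in auto)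
    then obtain h where h: "h \<in> hom_set C Z P" "m \<cdot> x = m \<cdot> p \<cdot> h"
      using embedding_factor[OF ek mx] Ck by auto
    have ph: "p \<cdot> h = x"
      using embedding_cancel[OF em] Cm Comp_hom[OF h(1) p] x h(2) Comp_assoc[OF h(1) p m(2)] by simp
    have "n \<cdot> (q \<cdot> h) = n \<cdot> y"
      using Comp_assoc[OF h(1) q n(2)] eq h(2) xy by simp
    then have qh: "q \<cdot> h = y"
      using embedding_cancel[OF en] Cn Comp_hom[OF h(1) q] y by simp
    \<comment> \<open>Agreement after \<open>p\<close> suffices, because \<open>m \<cdot> p\<close>
      can be cancelled.\<close>
    have "h' = h" if h': "h' \<in> hom_set C Z P" "p \<cdot> h' = x" for h'
      using embedding_cancel[OF ek, of h' Z h] Ck h' h(1) ph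
        Comp_assoc[OF h(1) p m(2)] Comp_assoc[OF h'(1) p m(2)] by simp
    then show ?thesis using h(1) ph qh by blast
  qed
  then show ?thesis
    unfolding is_pullback_iff[OF m(2) n(2) p q] using eq by blast
qed

text \<open>The meet of two conormal clusters is conormal, so it has an embedding; its image lies
  below both given images, so it factors through both \<open>m\<close> and \<open>n\<close>.\<close>

lemma embeddings_meet:
  assumes m: "m \<in> embeddings C F" "m \<in> hom_set C A X" and n: "n \<in> embeddings C F" "n \<in> hom_set C B X"
  obtains K u v where "u \<in> hom_set C K A" "v \<in> hom_set C K B" "m \<cdot> u = n \<cdot> v"
    "is_embedding C F X (Im C F m \<sqinter>\<^bsub>fib F X\<^esub> Im C F n) (m \<cdot> u)"
proof -
  note Cm = hom_setD[OF m(2)] and Cn = hom_setD[OF n(2)]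
  interpret X: bounded_lattice "fib F X" using Cm fib_lattice by simp
  obtain k where k: "is_embedding C F X (Im C F m \<sqinter>\<^bsub>fib F X\<^esub> Im C F n) k"
    using conormal_embedding conormal_meet conormal_Im m(2) n(2) Cm by metis
  have "Im C F k \<sqsubseteq>\<^bsub>fib F X\<^esub> Im C F m" "Im C F k \<sqsubseteq>\<^bsub>fib F X\<^esub> Im C F n"
    using embeddingD(2)[OF k] X.meet_left X.meet_right Im_closed m(2) n(2) by simp_all
  then obtain u v where "u \<in> hom_set C (Dom C k) A" "k = m \<cdot> u" "v \<in> hom_set C (Dom C k) B" "k = n \<cdot> v"
    using embedding_factor[OF embedding_of_Im[OF m(1)]] embedding_factor[OF embedding_of_Im[OF n(1)]]
      embeddingD(1)[OF k] Cm Cn by metis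
  then show thesis using that k by metis
qed

lemma embeddings_pullback_exists:
  assumes m: "m \<in> embeddings C F" "m \<in> hom_set C A X" and n: "n \<in> embeddings C F" "n \<in> hom_set C B X"
  shows "\<exists>p q. is_pullback C m n p q"
proof -
  obtain K u v where uv: "u \<in> hom_set C K A" "v \<in> hom_set C K B" "m \<cdot> u = n \<cdot> v"
    and e: "is_embedding C F X (Im C F m \<sqinter>\<^bsub>fib F X\<^esub> Im C F n) (m \<cdot> u)"
    using embeddings_meet[OF m n] .
  show ?thesis
    using pullback_of_embeddings[OF m n uv] Ker_embedding[OF e] embeddingD(2)[OF e]
      hom_setD[OF Comp_hom[OF uv(1) m(2)]] by auto
qed

text \<open>Compares the given pullback with the embedding \<open>m \<cdot> u\<close> of the meet:
  \<open>h\<close> and \<open>g\<close> are the comparison maps between the two vertices. As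
  \<open>h \<cdot> g\<close> is an identity, \<open>g\<close> has trivial kernel, and so has
  \<open>m \<cdot> p\<close>, which is \<open>g\<close> followed by an embedding.\<close>

lemma Im_Ker_pullback:
  assumes m: "m \<in> embeddings C F" "m \<in> hom_set C A X" and n: "n \<in> embeddings C F" "n \<in> hom_set C B X"
    and p: "p \<in> hom_set C P A" and q: "q \<in> hom_set C P B" and pb: "is_pullback C m n p q"
  shows "Ker C F (m \<cdot> p) = \<bottom>\<^bsub>fib F P\<^esub>" and "Im C F (m \<cdot> p) = Im C F m \<sqinter>\<^bsub>fib F X\<^esub> Im C F n"
proof -
  note Cm = hom_setD[OF m(2)] and Cn = hom_setD[OF n(2)] and Cp = hom_setD[OF p]
  interpret X: bounded_lattice "fib F X" using Cm fib_lattice by simp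
  have P: "P \<in> Ob C" using Cp by simp
  have eq: "m \<cdot> p = n \<cdot> q" using pb by (simp add: is_pullback_def)
  have univ: "\<exists>!h. h \<in> hom_set C Z P \<and> p \<cdot> h = x \<and> q \<cdot> h = y"
    if "x \<in> hom_set C Z A" "y \<in> hom_set C Z B" "m \<cdot> x = n \<cdot> y" for x y Z
    using pb that unfolding is_pullback_iff[OF m(2) n(2) p q] by blast
  obtain K u v where u: "u \<in> hom_set C K A" and v: "v \<in> hom_set C K B" and uv: "m \<cdot> u = n \<cdot> v"
    and k: "is_embedding C F X (Im C F m \<sqinter>\<^bsub>fib F X\<^esub> Im C F n) (m \<cdot> u)"
    using embeddings_meet[OF m n] .
  obtain h where h: "h \<in> hom_set C K P" "p \<cdot> h = u" "q \<cdot> h = v" using univ[OF u v uv] by blast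
  have mp: "m \<cdot> p \<in> hom_set C P X" and mu: "m \<cdot> u \<in> hom_set C K X"
    using Comp_hom p u m(2) by auto
  have mph: "m \<cdot> p \<cdot> h = m \<cdot> u" using Comp_assoc[OF h(1) p m(2)] h(2) by simp
  have le: "Im C F (m \<cdot> p) \<sqsubseteq>\<^bsub>fib F X\<^esub> Im C F m \<sqinter>\<^bsub>fib F X\<^esub> Im C F n"
  proof (rule X.meet_le)
    show "Im C F (m \<cdot> p) \<sqsubseteq>\<^bsub>fib F X\<^esub> Im C F m" using p m(2) by (rule Im_Comp_le)
    show "Im C F (m \<cdot> p) \<sqsubseteq>\<^bsub>fib F X\<^esub> Im C F n" unfolding eq using q n(2) by (rule Im_Comp_le)
  qed (use Im_closed m(2) n(2) mp in auto)
  \<comment> \<open>The meet is the image of \<open>m \<cdot> u\<close>, which factors through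
    \<open>m \<cdot> p\<close>; this is the inequality opposite to \<open>le\<close>.\<close>
  show "Im C F (m \<cdot> p) = Im C F m \<sqinter>\<^bsub>fib F X\<^esub> Im C F n"
    using le Im_Comp_le[OF h(1) mp] Im_closed[OF mp] Im_closed[OF mu] embeddingD(2)[OF k]
    unfolding mph by auto
  obtain g where g: "g \<in> hom_set C P K" "m \<cdot> p = m \<cdot> u \<cdot> g"
    using embedding_factor[OF k mp le] hom_setD[OF mu] by auto
  have hg: "h \<cdot> g \<in> hom_set C P P" using g(1) h(1) by (rule Comp_hom)
  have "m \<cdot> (p \<cdot> (h \<cdot> g)) = m \<cdot> p"
    using Comp_assoc[OF hg p m(2)] Comp_assoc[OF g(1) h(1) mp] mph g(2)[symmetric] by simp
  then have p1: "p \<cdot> (h \<cdot> g) = p"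
    using embedding_cancel[OF embedding_of_Im[OF m(1)]] Cm Comp_hom[OF hg p] p by simp
  have "n \<cdot> (q \<cdot> (h \<cdot> g)) = n \<cdot> q"
    using Comp_assoc[OF hg q n(2)] Comp_assoc[OF g(1) h(1) mp] mph g(2)[symmetric] eq by simp
  then have q1: "q \<cdot> (h \<cdot> g) = q"
    using embedding_cancel[OF embedding_of_Im[OF n(1)]] Cn Comp_hom[OF hg q] q by simp
  \<comment> \<open>The pullback cone factors through itself both by \<open>h \<cdot> g\<close> and
    by the identity.\<close>
  have "h \<cdot> g = Id C P"
    using univ[OF p q eq] p1 q1 hg Id_hom[OF P] Comp_Id[OF p] Comp_Id[OF q] by blast
  then have "Ker C F g = \<bottom>\<^bsub>fib F P\<^esub>"
    using Ker_split_mono[OF g(1) h(1)] by simp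
  then show "Ker C F (m \<cdot> p) = \<bottom>\<^bsub>fib F P\<^esub>"
    using Ker_Comp_eq[OF g(1) mu] Ker_embedding[OF k] hom_setD[OF mu] g(2) by simp
qed

end

section \<open>Pullback forms\<close>

lemma form_pullback_form:
  assumes "form D F" and "cat_functor C D T"
  shows "form C (pullback_form T F)"
proof -
  interpret cat_functor C D T by fact
  interpret form D F by fact
  show ?thesis
    by (intro form.intro form_axioms.intro dom.category_axioms)
      (simp_all add: on_ob on_arr[THEN dir_closed] on_arr[THEN inv_closed] on_arr[THEN dir_isotone]
        on_arr[THEN inv_isotone] on_arr[THEN adjoint] on_Comp on_Id dir_Id inv_Id
        dir_Comp[OF on_arr on_arr] inv_Comp[OF on_arr on_arr] fib_lattice)
qed

lemma (in cat_functor) Im_pullback_form: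
  "f \<in> hom_set C X Y \<Longrightarrow> Im C (pullback_form T F) f = Im D F (on_arr T f)"
  using on_arr[of f X Y] by (simp add: Im_def hom_set_def)

lemma (in cat_functor) Ker_pullback_form:
  "f \<in> hom_set C X Y \<Longrightarrow> Ker C (pullback_form T F) f = Ker D F (on_arr T f)"
  using on_arr[of f X Y] by (simp add: Ker_def hom_set_def)

text \<open>Bundling existence with preservation makes the pushout condition an instance of the
  pullback condition, taken for the opposite categories.\<close>

definition has_preserved_pullbacks ::
  "('o1, 'a1) cat \<Rightarrow> ('o2, 'a2) cat \<Rightarrow> ('o1, 'a1, 'o2, 'a2) fctr \<Rightarrow> 'a1 set \<Rightarrow> bool" where
  "has_preserved_pullbacks C D T \<M> \<longleftrightarrow> (\<forall>m \<in> \<M>. \<forall>n \<in> \<M>. Cod C m = Cod C n \<longrightarrow>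
     (\<exists>p q. is_pullback C m n p q) \<and>
     (\<forall>p q. is_pullback C m n p q \<longrightarrow>
        is_pullback D (on_arr T m) (on_arr T n) (on_arr T p) (on_arr T q)))"

definition has_preserved_pushouts ::
  "('o1, 'a1) cat \<Rightarrow> ('o2, 'a2) cat \<Rightarrow> ('o1, 'a1, 'o2, 'a2) fctr \<Rightarrow> 'a1 set \<Rightarrow> bool" where
  "has_preserved_pushouts C D T \<E> \<longleftrightarrow> (\<forall>d \<in> \<E>. \<forall>e \<in> \<E>. Dom C d = Dom C e \<longrightarrow>
     (\<exists>p q. is_pushout C d e p q) \<and>
     (\<forall>p q. is_pushout C d e p q \<longrightarrow>
        is_pushout D (on_arr T d) (on_arr T e) (on_arr T p) (on_arr T q)))"

lemma has_preserved_pullbacks_op: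
  "has_preserved_pullbacks (op_cat C) (op_cat D) T \<E> \<longleftrightarrow> has_preserved_pushouts C D T \<E>"
  by (simp add: has_preserved_pullbacks_def has_preserved_pushouts_def is_pullback_op)

section \<open>From a noetherian pullback form to the properties of the functor\<close>

locale noetherian_pullback_form = cat_functor C D T + cod: noetherian_form D F
  for C :: "('o1, 'a1) cat" and D :: "('o2, 'a2) cat"
    and T :: "('o1, 'a1, 'o2, 'a2) fctr" and F :: "('o2, 'a2, 'c) form_data" +
  assumes noetherian: "noetherian_form C (pullback_form T F)"
begin

sublocale pb: noetherian_form C "pullback_form T F" by (rule noetherian)

text \<open>The kernel of \<open>f\<close> in the pullback form is by definition the kernel of its
  value under \<open>T\<close>, so the kernel tests on the two sides coincide.\<close>

lemma on_arr_embeddings_iff: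
  "f \<in> hom_set C X Y \<Longrightarrow> on_arr T f \<in> embeddings D F \<longleftrightarrow> f \<in> embeddings C (pullback_form T F)"
  using pb.embeddings_iff[of f X Y] cod.embeddings_iff[OF on_arr] Ker_pullback_form[of f X Y F] by simp

lemma preserves_embeddings: "on_arr T ` embeddings C (pullback_form T F) \<subseteq> embeddings D F"
  using on_arr_embeddings_iff[OF pb.embeddings_arr] by blast

text \<open>An isomorphism has full image and trivial kernel. Both equations hold verbatim in the
  pullback form, where they imply invertibility.\<close>

lemma conservative: "conservative C D T"
  unfolding conservative_def
proof (intro ballI impI)
  fix f assume "f \<in> Arr C" and iso: "is_iso D (on_arr T f)"
  then have f: "f \<in> hom_set C (Dom C f) (Cod C f)" by (simp add: hom_set_def)
  show "is_iso C f"
    by (rule pb.iso_if_Im_Ker[OF f])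
      (simp_all add: cod.iso_Im_Ker[OF iso on_arr[OF f]] Im_pullback_form[OF f, of F] Ker_pullback_form[OF f, of F])
qed

text \<open>Image and kernel of the diagonal \<open>m \<cdot> p\<close> are known in the pullback
  form; they are the same clusters after applying \<open>T\<close>, where they characterize a
  pullback.\<close>

lemma has_preserved_pullbacks: "has_preserved_pullbacks C D T (embeddings C (pullback_form T F))"
  unfolding has_preserved_pullbacks_def
proof (intro ballI impI conjI allI)
  fix m n assume m: "m \<in> embeddings C (pullback_form T F)" and n: "n \<in> embeddings C (pullback_form T F)"
    and mn: "Cod C m = Cod C n"
  have mh: "m \<in> hom_set C (Dom C m) (Cod C m)" and nh: "n \<in> hom_set C (Dom C n) (Cod C m)"
    using pb.embeddings_arr[OF m] pb.embeddings_arr[OF n] mn by simp_all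
  show "\<exists>p q. is_pullback C m n p q"
    using m mh n nh by (rule pb.embeddings_pullback_exists)
  fix p q assume pq: "is_pullback C m n p q"
  have ph: "p \<in> hom_set C (Dom C p) (Dom C m)" and qh: "q \<in> hom_set C (Dom C p) (Dom C n)"
    and eq: "m \<cdot>\<^bsub>C\<^esub> p = n \<cdot>\<^bsub>C\<^esub> q"
    using pq by (simp_all add: is_pullback_def hom_set_def)
  note mp = dom.Comp_hom[OF ph mh]
  show "is_pullback D (on_arr T m) (on_arr T n) (on_arr T p) (on_arr T q)"
  proof (rule cod.pullback_of_embeddings)
    show "on_arr T m \<in> embeddings D F" "on_arr T n \<in> embeddings D F"
      using m n preserves_embeddings by auto
    show "on_arr T m \<cdot>\<^bsub>D\<^esub> on_arr T p = on_arr T n \<cdot>\<^bsub>D\<^esub> on_arr T q"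
      using on_Comp[OF ph mh] on_Comp[OF qh nh] eq by simp
    show "Ker D F (on_arr T m \<cdot>\<^bsub>D\<^esub> on_arr T p) = \<bottom>\<^bsub>fib F (on_ob T (Dom C p))\<^esub>"
      using pb.Im_Ker_pullback(1)[OF m mh n nh ph qh pq] Ker_pullback_form[OF mp, of F] on_Comp[OF ph mh]
      by simp
    show "Im D F (on_arr T m \<cdot>\<^bsub>D\<^esub> on_arr T p)
        = Im D F (on_arr T m) \<sqinter>\<^bsub>fib F (on_ob T (Cod C m))\<^esub> Im D F (on_arr T n)"
      using pb.Im_Ker_pullback(2)[OF m mh n nh ph qh pq] Im_pullback_form[OF mp, of F] on_Comp[OF ph mh]
        Im_pullback_form[OF mh, of F] Im_pullback_form[OF nh, of F] by simp
  qed (use mh nh ph qh on_arr in auto)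
qed

end

section \<open>From the properties of the functor to a noetherian pullback form\<close>

text \<open>
  The part of the converse implication that concerns \<open>\<M>\<close>; applied to the dual data it
  yields the part that concerns \<open>\<E>\<close>.
\<close>

locale preserved_factorization_system =
  proper_factorization_system C \<E> \<M> + cat_functor C D T + cod: noetherian_form D F
  for C :: "('o1, 'a1) cat" and \<E> \<M> :: "'a1 set" and D :: "('o2, 'a2) cat"
    and T :: "('o1, 'a1, 'o2, 'a2) fctr" and F :: "('o2, 'a2, 'c) form_data" +
  assumes preserves_left: "on_arr T ` \<E> \<subseteq> quotients D F"
    and preserves_right: "on_arr T ` \<M> \<subseteq> embeddings D F"
    and conservative: "conservative C D T"
    and pullbacks: "has_preserved_pullbacks C D T \<M>"
begin

sublocale pb: form C "pullback_form T F"
  using cod.form_axioms cat_functor_axioms by (rule form_pullback_form)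

lemma right_arr: "m \<in> \<M> \<Longrightarrow> m \<in> hom_set C (Dom C m) (Cod C m)"
  using right_class by (auto simp: hom_set_def)

lemma left_arr: "e \<in> \<E> \<Longrightarrow> e \<in> hom_set C (Dom C e) (Cod C e)"
  using left_class by (auto simp: hom_set_def)

lemma Ker_right:
  assumes "m \<in> \<M>"
  shows "Ker C (pullback_form T F) m = \<bottom>\<^bsub>fib F (on_ob T (Dom C m))\<^esub>"
proof -
  note mh = right_arr[OF assms]
  have "on_arr T m \<in> embeddings D F" using assms preserves_right by blast
  then show ?thesis
    unfolding cod.embeddings_iff[OF on_arr[OF mh]] Ker_pullback_form[OF mh] .
qed

text \<open>Quotients are embeddings in the opposite category, where the kernel test says that the
  image is full.\<close>

lemma Im_left:
  assumes "e \<in> \<E>"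
  shows "Im C (pullback_form T F) e = \<top>\<^bsub>fib F (on_ob T (Cod C e))\<^esub>"
proof -
  interpret op: noetherian_form "op_cat D" "op_form F"
    using cod.noetherian_form_axioms by (rule noetherian_form_op)
  note eh = left_arr[OF assms]
  have "on_arr T e \<in> quotients D F" using assms preserves_left by blast
  then show ?thesis
    using op.embeddings_iff[of "on_arr T e"] on_arr[OF eh]
    by (simp add: embeddings_op Ker_op Im_pullback_form[OF eh])
qed

lemma factor:
  assumes "f \<in> hom_set C X Y"
  obtains e m where "e \<in> \<E>" "m \<in> \<M>" "e \<in> hom_set C X (Dom C m)" "m \<in> hom_set C (Dom C m) Y"
    "f = m \<cdot>\<^bsub>C\<^esub> e"
proof -
  obtain e m where em: "e \<in> \<E>" "m \<in> \<M>" "Cod C e = Dom C m" "f = m \<cdot>\<^bsub>C\<^esub> e"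
    using factorization[of f] assms by (auto simp: hom_set_def)
  have e: "e \<in> hom_set C (Dom C e) (Dom C m)" using left_arr[OF em(1)] em(3) by simp
  have "X = Dom C e" "Y = Cod C m"
    using Comp_hom[OF e right_arr[OF em(2)]] assms em(4) by (auto simp: hom_set_def)
  then show thesis using that em e right_arr[OF em(2)] by simp
qed

text \<open>Precomposing with \<open>e\<close>, whose image is full, keeps the image; postcomposing
  with \<open>m\<close>, whose kernel is trivial, keeps the kernel.\<close>

lemma Im_Ker_factor:
  assumes "e \<in> \<E>" "m \<in> \<M>" "e \<in> hom_set C X (Dom C m)" "m \<in> hom_set C (Dom C m) Y"
  shows "Im C (pullback_form T F) (m \<cdot>\<^bsub>C\<^esub> e) = Im C (pullback_form T F) m"
    and "Ker C (pullback_form T F) (m \<cdot>\<^bsub>C\<^esub> e) = Ker C (pullback_form T F) e"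
  using pb.Im_Comp_eq[OF assms(3,4)] Im_left[OF assms(1)] pb.Ker_Comp_eq[OF assms(3,4)]
    Ker_right[OF assms(2)] hom_setD[OF assms(3)] by simp_all

text \<open>The inequality makes the projection \<open>q\<close> of the pullback to \<open>B\<close>
  invertible under \<open>T\<close>. Conservativity makes \<open>q\<close> itself invertible, and
  its inverse \<open>r\<close> gives the factor \<open>p \<cdot> r\<close>.\<close>

lemma right_factor:
  assumes m: "m \<in> \<M>" "m \<in> hom_set C A X" and n: "n \<in> \<M>" "n \<in> hom_set C B X"
    and le: "Im D F (on_arr T n) \<sqsubseteq>\<^bsub>fib F (on_ob T X)\<^esub> Im D F (on_arr T m)"
  shows "\<exists>h \<in> hom_set C B A. n = m \<cdot>\<^bsub>C\<^esub> h"
proof -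
  note Cm = hom_setD[OF m(2)] and Cn = hom_setD[OF n(2)]
  obtain p q where pq: "is_pullback C m n p q"
    and Tpq: "is_pullback D (on_arr T m) (on_arr T n) (on_arr T p) (on_arr T q)"
    using pullbacks m n Cm Cn unfolding has_preserved_pullbacks_def by metis
  define P where "P = Dom C p"
  have p: "p \<in> hom_set C P A" and q: "q \<in> hom_set C P B" and eq: "m \<cdot>\<^bsub>C\<^esub> p = n \<cdot>\<^bsub>C\<^esub> q"
    using pq Cm Cn by (simp_all add: is_pullback_def hom_set_def P_def)
  note Tm = on_arr[OF m(2)] and Tn = on_arr[OF n(2)] and Tp = on_arr[OF p] and Tq = on_arr[OF q]
  have eTm: "on_arr T m \<in> embeddings D F" and eTn: "on_arr T n \<in> embeddings D F"
    using m n preserves_right by auto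
  have TB: "on_ob T B \<in> Ob D" using cod.hom_setD[OF Tn] by simp
  have "\<exists>h \<in> hom_set D (on_ob T B) (on_ob T A). on_arr T n = on_arr T m \<cdot>\<^bsub>D\<^esub> h"
    using cod.embedding_factor[OF cod.embedding_of_Im[OF eTm], of "on_arr T n"] cod.hom_setD[OF Tm] Tn le
    by simp
  then obtain h where h: "h \<in> hom_set D (on_ob T B) (on_ob T A)" "on_arr T n = on_arr T m \<cdot>\<^bsub>D\<^esub> h"
    by blast
  \<comment> \<open>The cone consisting of \<open>h\<close> and the identity induces a section of
    the preserved projection.\<close>
  have "\<exists>s \<in> hom_set D (on_ob T B) (on_ob T P). on_arr T q \<cdot>\<^bsub>D\<^esub> s = Id D (on_ob T B)"
    using Tpq h cod.hom_setD[OF Tm] cod.hom_setD[OF Tn] cod.hom_setD[OF Tp] cod.hom_setD[OF h(1)]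
      cod.hom_setD[OF cod.Id_hom[OF TB]] cod.Comp_Id[OF Tn]
    unfolding is_pullback_def by metis
  then have "Im D F (on_arr T q) = \<top>\<^bsub>fib F (on_ob T B)\<^esub>"
    using cod.Im_split_epi[OF Tq] by blast
  \<comment> \<open>The diagonal of the preserved pullback has trivial kernel, and its last factor
    \<open>on_arr T n\<close> is an embedding, so the kernel of the diagonal is that of
    \<open>on_arr T q\<close>.\<close>
  moreover have "Ker D F (on_arr T q) = \<bottom>\<^bsub>fib F (on_ob T P)\<^esub>"
    using cod.Im_Ker_pullback(1)[OF eTm Tm eTn Tn Tp Tq Tpq] cod.Ker_Comp_eq[OF Tq Tn]
      cod.embeddings_iff[OF Tn] eTn Tpq
    by (simp add: is_pullback_def)
  ultimately have "is_iso D (on_arr T q)" by (intro cod.iso_if_Im_Ker[OF Tq])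
  then obtain r where r: "r \<in> hom_set C B P" "q \<cdot>\<^bsub>C\<^esub> r = Id C B"
    using conservative hom_setD[OF q] by (auto simp: conservative_def is_iso_def)
  have "n = m \<cdot>\<^bsub>C\<^esub> (p \<cdot>\<^bsub>C\<^esub> r)"
    using Comp_assoc[OF r(1) p m(2)] Comp_assoc[OF r(1) q n(2)] eq r(2) Comp_Id[OF n(2)] by simp
  then show ?thesis using Comp_hom[OF r(1) p] by blast
qed

text \<open>An arbitrary \<open>f\<close> has the same image as the \<M>-part of its factorization,
  so factoring that part through \<open>m\<close> suffices. Cancellation holds because \<M> consists
  of monomorphisms.\<close>

lemma right_embedding:
  assumes m: "m \<in> \<M>" "m \<in> hom_set C A X"
  shows "is_embedding C (pullback_form T F) X (Im C (pullback_form T F) m) m"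
proof (rule pb.embeddingI[OF m(2)])
  fix f Z assume f: "f \<in> hom_set C Z X"
    and le: "Im C (pullback_form T F) f \<sqsubseteq>\<^bsub>fib (pullback_form T F) X\<^esub> Im C (pullback_form T F) m"
  obtain e n where en: "e \<in> \<E>" "n \<in> \<M>" and e: "e \<in> hom_set C Z (Dom C n)"
    and n: "n \<in> hom_set C (Dom C n) X" and fne: "f = n \<cdot>\<^bsub>C\<^esub> e"
    using factor[OF f] .
  obtain h where h: "h \<in> hom_set C (Dom C n) A" "n = m \<cdot>\<^bsub>C\<^esub> h"
    using right_factor[OF m en(2) n] le Im_Ker_factor(1)[OF en e n] fne
      Im_pullback_form[OF n, of F] Im_pullback_form[OF m(2), of F] by auto
  have "f = m \<cdot>\<^bsub>C\<^esub> (h \<cdot>\<^bsub>C\<^esub> e)" using Comp_assoc[OF e h(1) m(2)] h(2) fne by simp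
  then show "\<exists>h\<in>hom_set C Z A. f = m \<cdot>\<^bsub>C\<^esub> h" using Comp_hom[OF e h(1)] by blast
next
  fix u v Z assume "u \<in> hom_set C Z A" "v \<in> hom_set C Z A" "m \<cdot>\<^bsub>C\<^esub> u = m \<cdot>\<^bsub>C\<^esub> v"
  then show "u = v"
    using mono[OF m(1)] hom_setD[OF m(2)] unfolding is_mono_def hom_set_def by auto
qed

text \<open>Orthogonality to \<E> is checked directly. In a square
  \<open>m \<cdot> u = v \<cdot> e\<close> the full image of \<open>e\<close> gives \<open>v\<close>
  the image of \<open>m \<cdot> u\<close>, which lies below that of \<open>m\<close>; factoring
  \<open>v\<close> through \<open>m\<close> yields the diagonal.\<close>

lemma embedding_right:
  assumes m: "is_embedding C (pullback_form T F) X S m"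
  shows "m \<in> \<M>"
proof -
  note mh = pb.embeddingD(1)[OF m]
  have "orthogonal C e m" if e: "e \<in> \<E>" for e
    unfolding orthogonal_def
  proof (intro ballI impI)
    fix u v assume u: "u \<in> hom_set C (Dom C e) (Dom C m)" and v': "v \<in> hom_set C (Cod C e) (Cod C m)"
      and sq: "m \<cdot>\<^bsub>C\<^esub> u = v \<cdot>\<^bsub>C\<^esub> e"
    note eh = left_arr[OF e]
    have v: "v \<in> hom_set C (Cod C e) X" using v' hom_setD[OF mh] by simp
    have "Im C (pullback_form T F) v = Im C (pullback_form T F) (m \<cdot>\<^bsub>C\<^esub> u)"
      unfolding sq using pb.Im_Comp_eq[OF eh v] Im_left[OF e] by simp
    then obtain d where d: "d \<in> hom_set C (Cod C e) (Dom C m)" "v = m \<cdot>\<^bsub>C\<^esub> d"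
      using pb.embedding_factor[OF m v] pb.Im_Comp_le[OF u mh] pb.embeddingD(2)[OF m] by auto
    have "d \<cdot>\<^bsub>C\<^esub> e = u"
      using pb.embedding_cancel[OF m Comp_hom[OF eh d(1)] u] Comp_assoc[OF eh d(1) mh] d(2) sq by simp
    then show "\<exists>!d. d \<in> hom_set C (Cod C e) (Dom C m) \<and> d \<cdot>\<^bsub>C\<^esub> e = u \<and> m \<cdot>\<^bsub>C\<^esub> d = v"
      using d pb.embedding_cancel[OF m] by blast
  qed
  then show ?thesis using right_class hom_setD[OF mh] by blast
qed

lemma embeddings_eq: "embeddings C (pullback_form T F) = \<M>"
  using embedding_right right_embedding right_arr unfolding embeddings_def by blast

lemma conormal_right:
  assumes "conormal C (pullback_form T F) X S"
  obtains m where "m \<in> \<M>" "m \<in> hom_set C (Dom C m) X" "Im C (pullback_form T F) m = S"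
proof -
  obtain f where f: "f \<in> hom_set C (Dom C f) X" "Im C (pullback_form T F) f = S"
    using assms by (auto simp: conormal_def hom_set_def)
  show thesis
    using factor[OF f(1)] Im_Ker_factor(1) f(2) that by metis
qed

text \<open>Both clusters are images of \<M>-morphisms, and the diagonal of their pullback has the
  meet as image, as is seen after applying \<open>T\<close>.\<close>

lemma conormal_meet:
  assumes S: "conormal C (pullback_form T F) X S" and R: "conormal C (pullback_form T F) X R"
  shows "conormal C (pullback_form T F) X (S \<sqinter>\<^bsub>fib F (on_ob T X)\<^esub> R)"
proof -
  obtain m where m: "m \<in> \<M>" and mh: "m \<in> hom_set C (Dom C m) X" and mS: "Im C (pullback_form T F) m = S"
    using conormal_right[OF S] .
  obtain n where n: "n \<in> \<M>" and nh: "n \<in> hom_set C (Dom C n) X" and nR: "Im C (pullback_form T F) n = R"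
    using conormal_right[OF R] .
  obtain p q where pq: "is_pullback C m n p q"
    and Tpq: "is_pullback D (on_arr T m) (on_arr T n) (on_arr T p) (on_arr T q)"
    using pullbacks m n hom_setD[OF mh] hom_setD[OF nh] unfolding has_preserved_pullbacks_def
    by metis
  have p: "p \<in> hom_set C (Dom C p) (Dom C m)" and q: "q \<in> hom_set C (Dom C p) (Dom C n)"
    using pq by (simp_all add: is_pullback_def hom_set_def)
  have "on_arr T m \<in> embeddings D F" "on_arr T n \<in> embeddings D F"
    using m n preserves_right by auto
  then have "Im D F (on_arr T m \<cdot>\<^bsub>D\<^esub> on_arr T p) = S \<sqinter>\<^bsub>fib F (on_ob T X)\<^esub> R"
    using cod.Im_Ker_pullback(2)[OF _ on_arr[OF mh] _ on_arr[OF nh] on_arr[OF p] on_arr[OF q] Tpq]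
      mS nR Im_pullback_form[OF mh, of F] Im_pullback_form[OF nh, of F] by simp
  then have "Im C (pullback_form T F) (m \<cdot>\<^bsub>C\<^esub> p) = S \<sqinter>\<^bsub>fib F (on_ob T X)\<^esub> R"
    using Im_pullback_form[OF Comp_hom[OF p mh], of F] on_Comp[OF p mh] by simp
  then show ?thesis
    using hom_setD[OF Comp_hom[OF p mh]] unfolding conormal_def by blast
qed

text \<open>The transport identities are those of \<open>F\<close> along the values of
  \<open>T\<close>. Embeddings and meets are settled above; quotients and joins come from the dual
  instance.\<close>

lemma noetherian_pullback_form:
  assumes "has_preserved_pushouts C D T \<E>"
  shows "noetherian_form C (pullback_form T F)" and "quotients C (pullback_form T F) = \<E>"
proof -
  \<comment> \<open>Passing to opposites exchanges the two classes and turns the assumed pushout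
    condition into the pullback condition of the locale.\<close>
  interpret op: preserved_factorization_system "op_cat C" \<M> \<E> "op_cat D" T "op_form F"
    using proper_factorization_system_axioms cat_functor_axioms cod.noetherian_form_axioms
      preserves_left preserves_right conservative assms
    by (intro preserved_factorization_system.intro preserved_factorization_system_axioms.intro
        proper_factorization_system_op cat_functor_op noetherian_form_op)
      (simp_all add: quotients_op embeddings_op conservative_op has_preserved_pullbacks_op)
  show quot: "quotients C (pullback_form T F) = \<E>"
    using op.embeddings_eq by (simp add: pullback_form_op embeddings_op)
  show "noetherian_form C (pullback_form T F)"
  proof unfold_locales
    fix f X Y assume f: "f \<in> hom_set C X Y"
    show "inv_tr (pullback_form T F) f (dir_tr (pullback_form T F) f S)
        = S \<squnion>\<^bsub>fib (pullback_form T F) X\<^esub> Ker C (pullback_form T F) f"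
      if "S \<in> carrier (fib (pullback_form T F) X)" for S
      using cod.inv_dir[OF on_arr[OF f]] that Ker_pullback_form[OF f, of F] by simp
    show "dir_tr (pullback_form T F) f (inv_tr (pullback_form T F) f R)
        = R \<sqinter>\<^bsub>fib (pullback_form T F) Y\<^esub> Im C (pullback_form T F) f"
      if "R \<in> carrier (fib (pullback_form T F) Y)" for R
      using cod.dir_inv[OF on_arr[OF f]] that Im_pullback_form[OF f, of F] by simp
    obtain e m where em: "e \<in> \<E>" "m \<in> \<M>" "e \<in> hom_set C X (Dom C m)" "m \<in> hom_set C (Dom C m) Y"
      and fme: "f = m \<cdot>\<^bsub>C\<^esub> e"
      using factor[OF f] .
    have "is_quotient C (pullback_form T F) X (Ker C (pullback_form T F) e) e"
      using op.right_embedding[of e "Dom C m" X] em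
      by (simp add: pullback_form_op is_embedding_op Im_op)
    moreover have "is_embedding C (pullback_form T F) Y (Im C (pullback_form T F) m) m"
      using right_embedding em by simp
    \<comment> \<open>Each factor has the universal property for its own kernel or image, and these
      are the kernel and image of \<open>f\<close>.\<close>
    ultimately show "\<exists>e m. is_quotient C (pullback_form T F) X (Ker C (pullback_form T F) f) e \<and>
        is_embedding C (pullback_form T F) Y (Im C (pullback_form T F) f) m \<and>
        Cod C e = Dom C m \<and> f = m \<cdot>\<^bsub>C\<^esub> e"
      using Im_Ker_factor[OF em] fme hom_setD[OF em(3)] by auto
  next
    fix X K L assume "normal C (pullback_form T F) X K" "normal C (pullback_form T F) X L"
    then show "normal C (pullback_form T F) X (K \<squnion>\<^bsub>fib (pullback_form T F) X\<^esub> L)"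
      using op.conormal_meet[of X K L] by (simp add: pullback_form_op conormal_op)
  qed (simp add: conormal_meet)
qed

end

section \<open>The equivalence of the two conditions\<close>

theorem theorem3p8:
  fixes C :: "('o1, 'a1) cat" and D :: "('o2, 'a2) cat"
    and \<E>\<^sub>C \<M>\<^sub>C :: "'a1 set" and \<E>\<^sub>D \<M>\<^sub>D :: "'a2 set"
    and F :: "('o2, 'a2, 'c) form_data"
    and T :: "('o1, 'a1, 'o2, 'a2) fctr"
  assumes "proper_factorization_system C \<E>\<^sub>C \<M>\<^sub>C"
    and "proper_factorization_system D \<E>\<^sub>D \<M>\<^sub>D"
    and "noetherian_form D F"
    and "induced_factorization_system D F = (\<E>\<^sub>D, \<M>\<^sub>D)"
    and "cat_functor C D T"
  shows
    "(noetherian_form C (pullback_form T F) \<and>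
      induced_factorization_system C (pullback_form T F) = (\<E>\<^sub>C, \<M>\<^sub>C))
     \<longleftrightarrow>
     (on_arr T ` \<E>\<^sub>C \<subseteq> \<E>\<^sub>D \<and> on_arr T ` \<M>\<^sub>C \<subseteq> \<M>\<^sub>D \<and>
      conservative C D T \<and>
      (\<forall>m \<in> \<M>\<^sub>C. \<forall>n \<in> \<M>\<^sub>C. Cod C m = Cod C n \<longrightarrow>
         (\<exists>p q. is_pullback C m n p q) \<and>
         (\<forall>p q. is_pullback C m n p q \<longrightarrow>
            is_pullback D (on_arr T m) (on_arr T n) (on_arr T p) (on_arr T q))) \<and>
      (\<forall>d \<in> \<E>\<^sub>C. \<forall>e \<in> \<E>\<^sub>C. Dom C d = Dom C e \<longrightarrow>
         (\<exists>p q. is_pushout C d e p q) \<and>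
         (\<forall>p q. is_pushout C d e p q \<longrightarrow>
            is_pushout D (on_arr T d) (on_arr T e) (on_arr T p) (on_arr T q))))"
  unfolding has_preserved_pullbacks_def[symmetric] has_preserved_pushouts_def[symmetric]
    induced_factorization_system_def prod.inject
proof (intro iffI; elim conjE)
  have D: "quotients D F = \<E>\<^sub>D" "embeddings D F = \<M>\<^sub>D"
    using assms(4) by (simp_all add: induced_factorization_system_def)
  {
    assume noeth: "noetherian_form C (pullback_form T F)"
      and E: "quotients C (pullback_form T F) = \<E>\<^sub>C" and M: "embeddings C (pullback_form T F) = \<M>\<^sub>C"
    interpret npf: noetherian_pullback_form C D T F
      using assms(3,5) noeth by (intro noetherian_pullback_form.intro noetherian_pullback_form_axioms.intro)
    \<comment> \<open>The dual instance supplies preservation of quotients and of pushouts.\<close>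
    interpret op: noetherian_pullback_form "op_cat C" "op_cat D" T "op_form F"
      using assms(3,5) noeth
      by (intro noetherian_pullback_form.intro noetherian_pullback_form_axioms.intro cat_functor_op)
        (simp_all add: noetherian_form_op pullback_form_op)
    show "on_arr T ` \<E>\<^sub>C \<subseteq> \<E>\<^sub>D \<and> on_arr T ` \<M>\<^sub>C \<subseteq> \<M>\<^sub>D \<and> conservative C D T \<and>
        has_preserved_pullbacks C D T \<M>\<^sub>C \<and> has_preserved_pushouts C D T \<E>\<^sub>C"
      using npf.preserves_embeddings npf.conservative npf.has_preserved_pullbacks
        op.preserves_embeddings op.has_preserved_pullbacks
      by (simp add: pullback_form_op embeddings_op has_preserved_pullbacks_op D E M)
  }
  {
    assume T: "on_arr T ` \<E>\<^sub>C \<subseteq> \<E>\<^sub>D" "on_arr T ` \<M>\<^sub>C \<subseteq> \<M>\<^sub>D" "conservative C D T"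
        "has_preserved_pullbacks C D T \<M>\<^sub>C" and po: "has_preserved_pushouts C D T \<E>\<^sub>C"
    interpret preserved_factorization_system C \<E>\<^sub>C \<M>\<^sub>C D T F
      using assms(1,3,5) T
      by (intro preserved_factorization_system.intro preserved_factorization_system_axioms.intro)
        (simp_all add: D)
    show "noetherian_form C (pullback_form T F) \<and>
        quotients C (pullback_form T F) = \<E>\<^sub>C \<and> embeddings C (pullback_form T F) = \<M>\<^sub>C"
      using noetherian_pullback_form[OF po] embeddings_eq by blast
  }
qed

end
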